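(* Let $\mathcal{G}$ be a monotonically shrinking temporal graph such that its underlying static graph is (1) a complete $k$-partite graph for some integer $k\ge 1$, or (2) a threshold graph. Then there exists a Nash equilibrium in the two-player reverse temporal Voronoi game $\mathrm{rVor}(\mathcal{G},2)$.
   Context: A temporal graph $\mathcal{G}=(V,(E_t)_{t=1}^\infty)$ consists of a finite nonempty vertex set $V$ and an infinite sequence of edge sets $E_t\subseteq\binom{V}{2}$; it is assumed that the sequence is eventually constant (finite lifetime), i.e. there is $\tau$ with $E_t=E_\tau$ for all $t\ge\tau$. The underlying static graph is $(V,\bigcup_{t\ge1}E_t)$. A static graph is complete $k$-partite if its vertex set is partitioned into $k$ nonempty parts such that two vertices are adjacent if and only if they lie in different parts. A threshold graph is a static graph that can be constructed by iteratively adding isolated vertices or dominating vertices (a dominating vertex being adjacent to all previously added vertices). $\mathcal{G}$ is monotonically shrinking if $E_{t+1}\subseteq E_t$ for all $t\ge 1$. A temporal walk from $u$ to $v$ is a sequence $(\{v_0=u,v_1\},t_1),(\{v_1,v_2\},t_2),\dots,(\{v_{d-1},v_d=v\},t_d)$ with $t_i<t_{i+1}$ for all $i\in\{1,\dots,d-1\}$ (strictly increasing times) and $\{v_{i-1},v_i\}\in E_{t_i}$ for all $i\in\{1,\dots,d\}$; its arrival time is $t_d$. The temporal distance $\mathrm{td}(u,v)$ is the minimum arrival time of a temporal walk from $u$ to $v$, with $\mathrm{td}(u,u)=0$ and $\mathrm{td}(u,v)=\infty$ if there is no such walk. In the two-player reverse temporal Voronoi game $\mathrm{rVor}(\mathcal{G},2)$,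 each player $i\in\{1,2\}$ selects one vertex $p_i\in V$ (equal choices are allowed). Player $i$ wins the set $U_i(p_1,p_2)=\{v\in V\mid \mathrm{td}(v,p_i)<\mathrm{td}(v,p_j)\}$, where $j\ne i$ is the other player, and her payoff is $u_i(p_1,p_2)=|U_i(p_1,p_2)|$. A profile $(p_1,p_2)\in V^2$ is a Nash equilibrium if $u_1(p',p_2)\le u_1(p_1,p_2)$ and $u_2(p_1,p')\le u_2(p_1,p_2)$ for all $p'\in V$. *)

theory Defs
  imports Main "HOL-Library.Disjoint_Sets" "HOL-Library.Extended_Nat" "HOL-Library.Ramsey"
begin

(* A temporal graph is given by its vertex set V and its edge sets E t for t >= 1;
   the value E 0 is irrelevant and never used. nsets V 2 is the set of all
   two-element subsets of V. *)
definition temporal_graph :: "'a set \<Rightarrow> (nat \<Rightarrow> 'a set set) \<Rightarrow> bool" where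
  "temporal_graph V E \<longleftrightarrow>
     finite V \<and> V \<noteq> {} \<and> (\<forall>t\<ge>1. E t \<subseteq> nsets V 2) \<and> (\<exists>\<tau>\<ge>1. \<forall>t\<ge>\<tau>. E t = E \<tau>)"

definition underlying_edges :: "(nat \<Rightarrow> 'a set set) \<Rightarrow> 'a set set" where
  "underlying_edges E = (\<Union>t\<in>{1..}. E t)"

definition monotonically_shrinking :: "(nat \<Rightarrow> 'a set set) \<Rightarrow> bool" where
  "monotonically_shrinking E \<longleftrightarrow> (\<forall>t\<ge>1. E (Suc t) \<subseteq> E t)"

(* Parts are nonempty because partition_on excludes the empty set. *)
definition complete_multipartite :: "nat \<Rightarrow> 'a set \<Rightarrow> 'a set set \<Rightarrow> bool" where
  "complete_multipartite k V F \<longleftrightarrow>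
     F \<subseteq> nsets V 2 \<and>
     (\<exists>P. partition_on V P \<and> finite P \<and> card P = k \<and>
        (\<forall>u\<in>V. \<forall>v\<in>V. {u, v} \<in> F \<longleftrightarrow> \<not> (\<exists>A\<in>P. u \<in> A \<and> v \<in> A)))"

inductive threshold_graph :: "'a set \<Rightarrow> 'a set set \<Rightarrow> bool" where
  empty: "threshold_graph {} {}"
| isolated: "threshold_graph V F \<Longrightarrow> x \<notin> V \<Longrightarrow> threshold_graph (insert x V) F"
| dominating: "threshold_graph V F \<Longrightarrow> x \<notin> V \<Longrightarrow>
    threshold_graph (insert x V) (F \<union> {{x, y} | y. y \<in> V})"

(* The walk ({v_0, v_1}, t_1), ..., ({v_(d-1), v_d}, t_d) with d >= 1 is encoded by
   vs = [v_0, ..., v_d] and ts = [t_1, ..., t_d]. *)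
definition temporal_walk ::
  "(nat \<Rightarrow> 'a set set) \<Rightarrow> 'a \<Rightarrow> 'a \<Rightarrow> 'a list \<Rightarrow> nat list \<Rightarrow> bool" where
  "temporal_walk E u v vs ts \<longleftrightarrow>
     ts \<noteq> [] \<and> length vs = Suc (length ts) \<and> hd vs = u \<and> last vs = v \<and>
     sorted_wrt (<) ts \<and>
     (\<forall>i<length ts. 1 \<le> ts ! i \<and> {vs ! i, vs ! Suc i} \<in> E (ts ! i))"

(* In enat, the infimum of a nonempty set is its minimum and that of the empty set is infinity. *)
definition temporal_dist :: "(nat \<Rightarrow> 'a set set) \<Rightarrow> 'a \<Rightarrow> 'a \<Rightarrow> enat" where
  "temporal_dist E u v =
     (if u = v then 0 else Inf {enat (last ts) | vs ts. temporal_walk E u v vs ts})"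

definition rvor_won :: "'a set \<Rightarrow> (nat \<Rightarrow> 'a set set) \<Rightarrow> 'a \<Rightarrow> 'a \<Rightarrow> 'a set" where
  "rvor_won V E p q = {v \<in> V. temporal_dist E v p < temporal_dist E v q}"

(* Payoff of the player choosing p against an opponent choosing q. The game is symmetric,
   so u_1(p_1, p_2) = rvor_payoff V E p_1 p_2 and u_2(p_1, p_2) = rvor_payoff V E p_2 p_1. *)
definition rvor_payoff :: "'a set \<Rightarrow> (nat \<Rightarrow> 'a set set) \<Rightarrow> 'a \<Rightarrow> 'a \<Rightarrow> nat" where
  "rvor_payoff V E p q = card (rvor_won V E p q)"

definition rvor_nash_equilibrium ::
  "'a set \<Rightarrow> (nat \<Rightarrow> 'a set set) \<Rightarrow> 'a \<Rightarrow> 'a \<Rightarrow> bool" where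
  "rvor_nash_equilibrium V E p1 p2 \<longleftrightarrow>
     p1 \<in> V \<and> p2 \<in> V \<and>
     (\<forall>p'\<in>V. rvor_payoff V E p' p2 \<le> rvor_payoff V E p1 p2) \<and>
     (\<forall>p'\<in>V. rvor_payoff V E p' p1 \<le> rvor_payoff V E p2 p1)"

end

theory Submission imports Defs begin

text \<open>
  In a shrinking graph the underlying graph is \<open>E 1\<close>, so adjacent vertices are at distance 1 and
  distinct non-adjacent ones at distance at least 2. Hence a player at \<open>p\<close> facing \<open>q\<close> wins only
  vertices outside the neighbourhood of \<open>q\<close>, apart from \<open>p\<close> itself.
  If two parts exist, take players in different parts: against \<open>q\<close> in the part \<open>B\<close>, no choice
  wins more than \<open>card B\<close> vertices, and every choice outside \<open>B\<close> wins that many.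
  In a threshold graph, or if there is only one part, some hub \<open>x\<close> is adjacent to every
  non-isolated vertex. It is a best response to every vertex, and against it nobody
  wins more than her own vertex.
\<close>

section \<open>Temporal walks and distances\<close>

lemma underlying_edges_shrinking:
  assumes "monotonically_shrinking E"
  shows "underlying_edges E = E 1"
proof -
  have "E t \<subseteq> E 1" if "t \<ge> 1" for t
    using that
  proof (induction t rule: dec_induct)
    case (step n)
    then show ?case using assms unfolding monotonically_shrinking_def by blast
  qed simp
  then show ?thesis unfolding underlying_edges_def by force
qed

lemma temporal_walk_last_ge:
  assumes "temporal_walk E u v vs ts"
  shows "1 \<le> last ts"
  using assms unfolding temporal_walk_def
  by (metis diff_less last_conv_nth length_greater_0_conv zero_less_one)

text \<open>Only the two end edges of the walk are inspected, which is all that is needed to see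
  that isolated vertices are unreachable.\<close>

lemma temporal_walk_edges:
  assumes "temporal_walk E u v vs ts"
  shows "\<exists>w. {u, w} \<in> underlying_edges E" "\<exists>w. {w, v} \<in> underlying_edges E"
proof -
  have edge: "{vs ! i, vs ! Suc i} \<in> underlying_edges E" if "i < length ts" for i
    using assms that unfolding temporal_walk_def underlying_edges_def by auto
  have ts: "ts \<noteq> []" and len: "length vs = Suc (length ts)" and "hd vs = u" "last vs = v"
    using assms by (auto simp: temporal_walk_def)
  then have "vs ! 0 = u" "vs ! length ts = v"
    by (metis hd_conv_nth length_0_conv nat.distinct(1),
        metis diff_Suc_1 last_conv_nth length_0_conv nat.distinct(1))
  then show "\<exists>w. {u, w} \<in> underlying_edges E" "\<exists>w. {w, v} \<in> underlying_edges E"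
    using edge[of 0] edge[of "length ts - 1"] ts by auto
qed

text \<open>Times start at 1 and increase strictly, so arrival at time 1 leaves room for one edge
  only.\<close>

lemma temporal_walk_last_eq_1:
  assumes "temporal_walk E u v vs ts" "last ts = 1"
  shows "{u, v} \<in> E 1"
proof -
  from assms(1) have ts: "ts \<noteq> []" "sorted_wrt (<) ts" "length vs = Suc (length ts)"
    "hd vs = u" "last vs = v" "\<And>i. i < length ts \<Longrightarrow> 1 \<le> ts ! i \<and> {vs ! i, vs ! Suc i} \<in> E (ts ! i)"
    unfolding temporal_walk_def by auto
  have "length ts = 1"
  proof (rule ccontr)
    assume "length ts \<noteq> 1"
    then have "0 < length ts - 1" using ts(1) by (cases ts) auto
    then have "ts ! 0 < ts ! (length ts - 1)"
      using sorted_wrt_nth_less[OF ts(2)] by simp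
    then show False using ts(1) ts(6)[of 0] assms(2) by (auto simp: last_conv_nth)
  qed
  then obtain t where "ts = [t]" by (cases ts) auto
  moreover from this ts(3) obtain a b where "vs = [a, b]"
    by (auto simp: length_Suc_conv)
  ultimately show ?thesis using ts(4,5) ts(6)[of 0] assms(2) by simp
qed

lemma temporal_dist_self [simp]: "temporal_dist E u u = 0"
  by (simp add: temporal_dist_def)

lemma temporal_dist_ge_1: "u \<noteq> v \<Longrightarrow> 1 \<le> temporal_dist E u v"
  unfolding temporal_dist_def using temporal_walk_last_ge
  by (fastforce intro!: Inf_greatest simp: one_enat_def)

lemma temporal_dist_pos: "u \<noteq> v \<Longrightarrow> 0 < temporal_dist E u v"
  using temporal_dist_ge_1[of u v E] by (metis i0_less not_one_le_zero)

lemma temporal_dist_eq_1: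
  assumes "u \<noteq> v" "{u, v} \<in> E 1"
  shows "temporal_dist E u v = 1"
proof (rule antisym[OF _ temporal_dist_ge_1[OF assms(1)]])
  have "temporal_walk E u v [u, v] [1]"
    using assms by (simp add: temporal_walk_def)
  then have "enat (last [1]) \<in> {enat (last ts) | vs ts. temporal_walk E u v vs ts}"
    by blast
  then show "temporal_dist E u v \<le> 1"
    using assms(1) by (simp add: temporal_dist_def Inf_lower one_enat_def)
qed

lemma temporal_dist_gt_1:
  assumes "u \<noteq> v" "{u, v} \<notin> E 1"
  shows "1 < temporal_dist E u v"
proof -
  have "2 \<le> last ts" if w: "temporal_walk E u v vs ts" for vs ts
    using temporal_walk_last_ge[OF w] temporal_walk_last_eq_1[OF w] assms(2) by force
  then have "(2::enat) \<le> temporal_dist E u v"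
    unfolding temporal_dist_def using assms(1)
    by (auto intro!: Inf_greatest simp: numeral_eq_enat)
  moreover have "(1::enat) < 2" by (simp add: one_enat_def numeral_eq_enat)
  ultimately show ?thesis by (rule less_le_trans[rotated])
qed

lemma temporal_dist_isolated:
  assumes "u \<noteq> v" "(\<forall>e\<in>underlying_edges E. u \<notin> e) \<or> (\<forall>e\<in>underlying_edges E. v \<notin> e)"
  shows "temporal_dist E u v = \<infinity>"
proof -
  have "\<not> temporal_walk E u v vs ts" for vs ts
    using temporal_walk_edges[of E u v vs ts] assms(2) by blast
  \<comment> \<open>The infimum is now taken over the empty set, hence the top element of
    \<open>enat\<close>.\<close>
  then show ?thesis using assms(1) by (simp add: temporal_dist_def top_enat_def)
qed

section \<open>Vertices that a player can win\<close>

lemma rvor_won_adjacent: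
  assumes "v \<in> rvor_won V E p q" "v \<noteq> p"
  shows "v \<noteq> q \<and> {v, q} \<notin> E 1"
proof -
  have less: "temporal_dist E v p < temporal_dist E v q"
    using assms(1) by (simp add: rvor_won_def)
  then have "v \<noteq> q" by auto
  \<comment> \<open>Since \<open>v\<close> differs from \<open>p\<close>, the distance to
    \<open>p\<close> is at least 1, and the one to \<open>q\<close> exceeds it.\<close>
  moreover have "1 < temporal_dist E v q"
    using temporal_dist_ge_1[OF assms(2)] less by (rule le_less_trans)
  ultimately show ?thesis using temporal_dist_eq_1[of v q E] by auto
qed

lemma rvor_won_self: "p \<in> V \<Longrightarrow> p \<noteq> q \<Longrightarrow> p \<in> rvor_won V E p q"
  using temporal_dist_pos[of p q E] by (simp add: rvor_won_def)

text \<open>Winning is a strict inequality, so the distance from \<open>v\<close> to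
  \<open>p\<close> is finite; a walk joins them and has an edge at each end.\<close>

lemma rvor_won_not_isolated:
  assumes "v \<in> rvor_won V E p q" "v \<noteq> p"
  shows "\<exists>e\<in>underlying_edges E. v \<in> e" "\<exists>e\<in>underlying_edges E. p \<in> e"
proof -
  have "temporal_dist E v p \<noteq> \<infinity>"
    using assms(1) by (cases "temporal_dist E v p") (auto simp: rvor_won_def)
  then show "\<exists>e\<in>underlying_edges E. v \<in> e" "\<exists>e\<in>underlying_edges E. p \<in> e"
    using temporal_dist_isolated[OF assms(2)] by metis+
qed

section \<open>Players in different parts of a complete multipartite graph\<close>

lemma rvor_payoff_multipartite_le:
  assumes "finite V" "B \<subseteq> V" "q \<in> B"
    and adj: "\<And>v. v \<in> V - B \<Longrightarrow> {v, q} \<in> E 1"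
  shows "rvor_payoff V E p q \<le> card B"
proof -
  have fin: "finite B" using assms(1,2) by (rule finite_subset[rotated])
  \<comment> \<open>Vertices outside \<open>B\<close> are adjacent to \<open>q\<close>, so besides
    \<open>B - {q}\<close> only \<open>p\<close> itself can be won, wherever \<open>p\<close>
    lies.\<close>
  have "rvor_won V E p q \<subseteq> insert p (B - {q})"
    using rvor_won_adjacent[of _ V E p q] adj by (fastforce simp: rvor_won_def)
  then have "rvor_payoff V E p q \<le> card (insert p (B - {q}))"
    unfolding rvor_payoff_def using fin by (auto intro: card_mono)
  also have "\<dots> \<le> Suc (card (B - {q}))"
    using fin by (simp add: card_insert_if)
  also have "\<dots> = card B" using fin assms(3) by (rule card_Suc_Diff1)
  finally show ?thesis .
qed

text \<open>On \<open>B - {q}\<close> distance 1 to \<open>p\<close> beats a distance above 1 to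
  \<open>q\<close>. The vertex \<open>q\<close> is lost, but \<open>p\<close>, lying outside
  \<open>B\<close>, makes up for it.\<close>

lemma rvor_payoff_multipartite_ge:
  assumes "finite V" "B \<subseteq> V" "q \<in> B" "p \<in> V - B"
    and adj: "\<And>v. v \<in> B \<Longrightarrow> {v, p} \<in> E 1"
    and nadj: "\<And>v. v \<in> B \<Longrightarrow> {v, q} \<notin> E 1"
  shows "card B \<le> rvor_payoff V E p q"
proof -
  have fin: "finite B" using assms(1,2) by (rule finite_subset[rotated])
  have "temporal_dist E v p < temporal_dist E v q" if v: "v \<in> B" "v \<noteq> q" for v
  proof -
    have "temporal_dist E v p = 1"
      using v(1) assms(4) by (intro temporal_dist_eq_1 adj) auto
    then show ?thesis using temporal_dist_gt_1[of v q E] nadj v by auto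
  qed
  then have "insert p (B - {q}) \<subseteq> rvor_won V E p q"
    using rvor_won_self[of p V q E] assms(2-4) by (auto simp: rvor_won_def)
  then have "card (insert p (B - {q})) \<le> rvor_payoff V E p q"
    unfolding rvor_payoff_def using assms(1) by (intro card_mono) (auto simp: rvor_won_def)
  moreover have "card (insert p (B - {q})) = Suc (card (B - {q}))"
    using fin assms(4) by simp
  ultimately show ?thesis using card_Suc_Diff1[OF fin assms(3)] by simp
qed

lemma nash_equilibrium_multipartite:
  assumes "finite V" "partition_on V P" "A \<in> P" "B \<in> P" "A \<noteq> B"
    and edges: "\<And>u v. u \<in> V \<Longrightarrow> v \<in> V \<Longrightarrow> {u, v} \<in> E 1 \<longleftrightarrow> \<not> (\<exists>C\<in>P. u \<in> C \<and> v \<in> C)"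
  shows "\<exists>p q. rvor_nash_equilibrium V E p q"
proof -
  have sub: "C \<subseteq> V" if "C \<in> P" for C
    using partition_onD1[OF assms(2)] that by auto
  have disj: "C = D" if "C \<in> P" "D \<in> P" "u \<in> C" "u \<in> D" for C D u
    using partition_onD2[OF assms(2)] that unfolding disjoint_def by auto
  have adj: "{v, w} \<in> E 1 \<longleftrightarrow> w \<notin> C" if "C \<in> P" "v \<in> C" "w \<in> V" for C v w
  proof -
    have "w \<in> C" if "D \<in> P" "v \<in> D" "w \<in> D" for D
      using disj[OF \<open>C \<in> P\<close> that(1) \<open>v \<in> C\<close> that(2)] that(3) by simp
    then show ?thesis using edges[of v w] that sub[of C] by fast
  qed
  \<comment> \<open>Stated for arbitrary distinct parts so that swapping them covers both players;
    \<open>card D\<close> separates the two payoffs.\<close>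
  have best: "rvor_payoff V E p' q \<le> rvor_payoff V E p q"
    if CD: "C \<in> P" "D \<in> P" "C \<noteq> D" "p \<in> C" "q \<in> D" for C D p q p'
  proof (rule order_trans)
    have V: "p \<in> V - D" "q \<in> V"
      using disj[OF CD(1,2,4)] CD sub by auto
    have "{v, q} \<in> E 1" if "v \<in> V - D" for v
      using adj[OF CD(2,5), of v] that by (simp add: insert_commute)
    then show "rvor_payoff V E p' q \<le> card D"
      using sub[OF CD(2)] CD(5) by (intro rvor_payoff_multipartite_le assms(1))
    have "{v, p} \<in> E 1" "{v, q} \<notin> E 1" if "v \<in> D" for v
      using adj[OF CD(2) that] V CD(5) by auto
    then show "card D \<le> rvor_payoff V E p q"
      using sub[OF CD(2)] CD(5) V(1) by (intro rvor_payoff_multipartite_ge assms(1))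
  qed
  have "A \<noteq> {}" "B \<noteq> {}" using partition_onD3[OF assms(2)] assms(3,4) by auto
  then obtain p q where "p \<in> A" "q \<in> B" by auto
  then have "rvor_nash_equilibrium V E p q"
    using best[of A B p q] best[of B A q p] assms(3-5) sub[of A] sub[of B]
    unfolding rvor_nash_equilibrium_def by auto
  then show ?thesis by blast
qed

section \<open>Hubs and threshold graphs\<close>

lemma threshold_graph_edges: "threshold_graph V F \<Longrightarrow> e \<in> F \<Longrightarrow> e \<subseteq> V"
  by (induction rule: threshold_graph.induct) auto

text \<open>A new dominating vertex is a hub at once. A new isolated vertex preserves the old hub,
  or is the hub itself if it is the first vertex.\<close>

lemma threshold_graph_hub:
  assumes "threshold_graph V F" "V \<noteq> {}"
  shows "\<exists>x\<in>V. \<forall>v\<in>V. v = x \<or> {v, x} \<in> F \<or> (\<forall>e\<in>F. v \<notin> e)"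
  using assms
proof (induction rule: threshold_graph.induct)
  case (isolated V F y)
  have "\<forall>e\<in>F. y \<notin> e" using threshold_graph_edges[OF isolated(1)] isolated(2) by blast
  then show ?case using isolated.IH by (cases "V = {}") auto
next
  case (dominating V F y)
  then show ?case by (auto simp: insert_commute)
qed simp

text \<open>A won vertex other than \<open>p\<close> is neither \<open>x\<close> nor a neighbour of
  \<open>x\<close>, hence isolated, and so it could not reach \<open>p\<close>.\<close>

lemma rvor_payoff_hub_le:
  assumes "E 1 = underlying_edges E"
    and hub: "\<And>v. v \<in> V \<Longrightarrow> v = x \<or> {v, x} \<in> E 1 \<or> (\<forall>e\<in>E 1. v \<notin> e)"
  shows "rvor_payoff V E p x \<le> 1"
proof -
  have "v = p" if v: "v \<in> rvor_won V E p x" for v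
  proof (rule ccontr)
    assume "v \<noteq> p"
    then have "v \<noteq> x" "{v, x} \<notin> E 1" using rvor_won_adjacent[OF v] by auto
    then have "\<forall>e\<in>E 1. v \<notin> e" using hub v by (auto simp: rvor_won_def)
    then show False using rvor_won_not_isolated(1)[OF v \<open>v \<noteq> p\<close>] assms(1) by simp
  qed
  then have "rvor_won V E p x \<subseteq> {p}" by auto
  then show ?thesis unfolding rvor_payoff_def
    by (metis card.empty card_1_singleton_iff le_numeral_extra(4) subset_singletonD zero_le_one One_nat_def)
qed

text \<open>Whatever \<open>p'\<close> wins, apart from \<open>p'\<close> itself, \<open>x\<close>
  wins too. If \<open>x\<close> does not win \<open>p'\<close>, then \<open>p'\<close> is traded for
  \<open>x\<close>, which \<open>p'\<close> does not win.\<close>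

lemma rvor_payoff_le_hub:
  assumes "finite V" "x \<in> V" "p \<noteq> x" "p \<in> V" "p' \<in> V" "E 1 = underlying_edges E"
    and hub: "\<And>v. v \<in> V \<Longrightarrow> v = x \<or> {v, x} \<in> E 1 \<or> (\<forall>e\<in>E 1. v \<notin> e)"
  shows "rvor_payoff V E p' p \<le> rvor_payoff V E x p"
proof -
  let ?U = "rvor_won V E p' p" and ?W = "rvor_won V E x p"
  have fin: "finite ?W" using assms(1) by (simp add: rvor_won_def)
  have x: "x \<in> ?W" using assms(2,3) by (auto intro: rvor_won_self)
  have U: "v \<in> ?W" if v: "v \<in> ?U" "v \<noteq> p'" for v
  proof (cases "v = x")
    case False
    have V: "v \<in> V" using v(1) by (auto simp: rvor_won_def)
    \<comment> \<open>As \<open>v\<close> reaches \<open>p'\<close>, it is not isolated, so it is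
      adjacent to the hub.\<close>
    have "temporal_dist E v x = 1"
      using hub[OF V] False rvor_won_not_isolated(1)[OF v] assms(6) by (auto intro: temporal_dist_eq_1)
    moreover have "1 < temporal_dist E v p"
      using rvor_won_adjacent[OF v] temporal_dist_gt_1[of v p E] by blast
    ultimately show ?thesis using V by (simp add: rvor_won_def)
  qed (simp add: x)
  show ?thesis
  proof (cases "p' \<in> ?W")
    case True
    then show ?thesis unfolding rvor_payoff_def using U fin by (intro card_mono) auto
  next
    case False
    \<comment> \<open>If \<open>p'\<close> won \<open>x\<close>, it would be non-isolated, hence
      adjacent to \<open>x\<close>. As \<open>x\<close> does not win \<open>p'\<close>, also
      \<open>p'\<close> and \<open>p\<close> would be adjacent, which makes \<open>p\<close>
      non-isolated and so adjacent to \<open>x\<close>. But \<open>p'\<close> cannot win a neighbour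
      of \<open>p\<close> other than itself.\<close>
    have "x \<notin> ?U \<or> ?U = {}"
    proof (rule disjCI, rule notI)
      assume "?U \<noteq> {}" and xU: "x \<in> ?U"
      then have "p' \<noteq> p" by (auto simp: rvor_won_def)
      have "p' \<noteq> x" using False x by auto
      then have "temporal_dist E p' x = 1"
        using hub[OF assms(5)] rvor_won_not_isolated(2)[OF xU] assms(6) by (auto intro: temporal_dist_eq_1)
      then have "{p', p} \<in> E 1"
        using False assms(5) temporal_dist_gt_1[OF \<open>p' \<noteq> p\<close>, of E] by (auto simp: rvor_won_def)
      then have "{x, p} \<in> E 1" using hub[OF assms(4)] assms(3) by (auto simp: insert_commute)
      then show False using rvor_won_adjacent[OF xU] \<open>p' \<noteq> x\<close> by auto
    qed
    then have "?U \<subseteq> insert p' (?W - {x})" using U by auto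
    then have "card ?U \<le> card (insert p' (?W - {x}))" using fin by (intro card_mono) auto
    also have "\<dots> \<le> Suc (card (?W - {x}))" using fin by (simp add: card_insert_if)
    also have "\<dots> = card ?W" using fin x by (rule card_Suc_Diff1)
    finally show ?thesis unfolding rvor_payoff_def .
  qed
qed

lemma nash_equilibrium_hub:
  assumes "finite V" "x \<in> V" "E 1 = underlying_edges E"
    and hub: "\<And>v. v \<in> V \<Longrightarrow> v = x \<or> {v, x} \<in> E 1 \<or> (\<forall>e\<in>E 1. v \<notin> e)"
  shows "\<exists>p q. rvor_nash_equilibrium V E p q"
proof (cases "V = {x}")
  case True
  then have "rvor_nash_equilibrium V E x x" by (simp add: rvor_nash_equilibrium_def)
  then show ?thesis by blast
next
  case False
  \<comment> \<open>Any second vertex will do: winning itself already attains the maximum 1 against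
    \<open>x\<close>.\<close>
  then obtain p where p: "p \<in> V" "p \<noteq> x" using assms(2) by blast
  have "finite (rvor_won V E p x)" using assms(1) by (simp add: rvor_won_def)
  then have "1 \<le> rvor_payoff V E p x"
    using rvor_won_self[OF p] unfolding rvor_payoff_def
    by (metis One_nat_def Suc_leI card_gt_0_iff empty_iff)
  then have "rvor_nash_equilibrium V E x p"
    unfolding rvor_nash_equilibrium_def
    using assms(2) p rvor_payoff_le_hub[OF assms(1,2) p(2,1) _ assms(3) hub]
      order_trans[OF rvor_payoff_hub_le[where E = E, OF assms(3) hub]] by blast
  then show ?thesis by blast
qed

theorem theorem9:
  fixes V :: "'a set" and E :: "nat \<Rightarrow> 'a set set"
  assumes "temporal_graph V E"
    and "monotonically_shrinking E"
    and "(\<exists>k\<ge>1. complete_multipartite k V (underlying_edges E)) \<or>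
         threshold_graph V (underlying_edges E)"
  shows "\<exists>p1 p2. rvor_nash_equilibrium V E p1 p2"
proof -
  have V: "finite V" "V \<noteq> {}" using assms(1) by (auto simp: temporal_graph_def)
  have E1: "underlying_edges E = E 1"
    using assms(2) by (rule underlying_edges_shrinking)
  from assms(3) show ?thesis
  proof
    assume "\<exists>k\<ge>1. complete_multipartite k V (underlying_edges E)"
    then obtain P where P: "partition_on V P" "E 1 \<subseteq> nsets V 2"
      and "\<forall>u\<in>V. \<forall>v\<in>V. {u, v} \<in> E 1 \<longleftrightarrow> \<not> (\<exists>C\<in>P. u \<in> C \<and> v \<in> C)"
      unfolding complete_multipartite_def E1 by metis
    then have edges: "{u, v} \<in> E 1 \<longleftrightarrow> \<not> (\<exists>C\<in>P. u \<in> C \<and> v \<in> C)"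
      if "u \<in> V" "v \<in> V" for u v
      using that by simp
    show ?thesis
    proof (cases "\<exists>A\<in>P. \<exists>B\<in>P. A \<noteq> B")
      case True
      then obtain A B where "A \<in> P" "B \<in> P" "A \<noteq> B" by blast
      from V(1) P(1) this edges show ?thesis by (rule nash_equilibrium_multipartite)
    next
      case False
      have "{u, v} \<notin> E 1" if "u \<in> V" "v \<in> V" for u v
        using edges[OF that] that False partition_onD1[OF P(1)] by blast
      then have "E 1 = {}"
        using P(2) unfolding nsets_def by (force simp: card_2_iff)
      \<comment> \<open>Without edges every vertex is isolated, so any vertex serves as a
        hub.\<close>
      then show ?thesis
        using nash_equilibrium_hub[where E = E, OF V(1) _ E1[symmetric]] V(2) by blast
    qed
  next
    assume "threshold_graph V (underlying_edges E)"
    then obtain x where "x \<in> V" "\<forall>v\<in>V. v = x \<or> {v, x} \<in> E 1 \<or> (\<forall>e\<in>E 1. v \<notin> e)"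
      using threshold_graph_hub V(2) E1 by metis
    then show ?thesis using nash_equilibrium_hub[where E = E, OF V(1) _ E1[symmetric]] by blast
  qed
qed

end
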